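(* Let $A$ be a convex $n$-gon in $\mathbb{R}^2$. If $Q\in\operatorname{conv}(A)$ then $L_A(Q)\in\operatorname{conv}(A)$. (Here $L_A(Q)$ denotes the image of $Q$ under the projective map of $\mathbb{R}^2\subseteq\mathbb{P}^2$ induced by the linear map $L_A:\mathbb{R}^3\to\mathbb{R}^3$; the assertion includes that, for $Q=(x,y)\in\operatorname{conv}(A)$, the vector $L_A([x\ \ y\ \ 1]^T)$ has nonzero third coordinate, so that $L_A(Q)$ is a well-defined point of $\mathbb{R}^2$.)
   Context: A convex $n$-gon ($n\ge3$) is a cyclically ordered tuple $A=(A_1,\ldots,A_n)$ of points $A_i=(x_i,y_i)$ of $\mathbb{R}^2$ that are, in this order, the vertices of a convex polygon, with no three vertices collinear; indices are taken modulo $n$. $\operatorname{conv}(A)$ is the convex hull of the vertices of $A$. Let $u_i=[x_i\ \ y_i\ \ 1]^T\in\mathbb{R}^3$. The linear map $L_A:\mathbb{R}^3\to\mathbb{R}^3$ is defined by $$L_A(v)=nv-\sum_{j=1}^n\frac{|u_{j-1},v,u_{j+1}|}{|u_{j-1},u_j,u_{j+1}|}\,u_j,$$ where $|\cdot,\cdot,\cdot|$ is the determinant of three vectors. A point $(x,y)\in\mathbb{R}^2$ is identified with the point of $\mathbb{P}^2$ represented by $[x\ \ y\ \ 1]^T$; the induced projective map sends $(x,y)$ to $(a/c,b/c)$, where $[a\ \ b\ \ c]^T=L_A([x\ \ y\ \ 1]^T)$, whenever $c\ne0$. *)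

theory Defs
  imports "HOL-Analysis.Analysis"
begin

text \<open>
  A cyclically ordered tuple is a list \<open>A\<close> of length \<open>n\<close>, indexed by \<open>0, \<dots>, n - 1\<close> modulo \<open>n\<close>.
  It is a convex \<open>n\<close>-gon if its entries are exactly the vertices (extreme points) of their
  convex hull and the segments between cyclically consecutive entries are edges, that is,
  one-dimensional faces, of that hull. Both orientations are allowed.
\<close>

definition convex_polygon :: "(real^2) list \<Rightarrow> bool" where
  "convex_polygon A \<longleftrightarrow>
     length A \<ge> 3 \<and> distinct A \<and>
     (\<forall>i<length A. (A ! i) extreme_point_of (convex hull (set A))) \<and>
     (\<forall>i<length A. closed_segment (A ! i) (A ! (Suc i mod length A))
        edge_of (convex hull (set A))) \<and>
     (\<forall>i<length A. \<forall>j<length A. \<forall>k<length A.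
        i \<noteq> j \<longrightarrow> j \<noteq> k \<longrightarrow> i \<noteq> k \<longrightarrow> \<not> collinear {A ! i, A ! j, A ! k})"

definition hom_coords :: "real^2 \<Rightarrow> real^3" where
  "hom_coords p = vector [p $ 1, p $ 2, 1]"

text \<open>Meaningful only for \<open>v\<close> with nonzero third coordinate.\<close>

definition affine_point :: "real^3 \<Rightarrow> real^2" where
  "affine_point v = vector [v $ 1 / v $ 3, v $ 2 / v $ 3]"

text \<open>\<open>transpose\<close> turns the three vectors, listed as rows, into the columns.\<close>

definition det3 :: "real^3 \<Rightarrow> real^3 \<Rightarrow> real^3 \<Rightarrow> real" where
  "det3 u v w = det (transpose (vector [u, v, w] :: real^3^3))"

text \<open>
  The index \<open>j - 1\<close> modulo \<open>n\<close> is written \<open>(j + n - 1) mod n\<close>, since subtraction on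
  natural numbers truncates.
\<close>

definition L_map :: "(real^2) list \<Rightarrow> real^3 \<Rightarrow> real^3" where
  "L_map A v =
     (let n = length A;
          u = (\<lambda>i. hom_coords (A ! (i mod n)))
      in real n *\<^sub>R v -
         (\<Sum>j<n. (det3 (u (j + n - 1)) v (u (j + 1)) /
                  det3 (u (j + n - 1)) (u j) (u (j + 1))) *\<^sub>R u j))"

lemma det3_expand:
  "det3 u v w = u$1 * v$2 * w$3 + v$1 * w$2 * u$3 + w$1 * u$2 * v$3
              - u$1 * w$2 * v$3 - v$1 * u$2 * w$3 - w$1 * v$2 * u$3"
  by (simp add: det3_def det_3 transpose_def algebra_simps)

lemma linear_L_map: "linear (L_map A)"
proof -
  have add: "det3 a (x + y) b = det3 a x b + det3 a y b" for a x y b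
    by (simp add: det3_expand algebra_simps)
  have scale: "det3 a (c *\<^sub>R x) b = c * det3 a x b" for a x b c
    by (simp add: det3_expand algebra_simps)
  show ?thesis
    unfolding L_map_def Let_def
    by (rule linearI)
      (simp_all add: add scale add_divide_distrib scaleR_add_left scaleR_add_right
        sum.distrib scaleR_right_diff_distrib scaleR_right.sum mult.commute)
qed

end

theory Submission
  imports Defs
begin

text \<open>
  Write \<open>u\<^sub>j\<close> for the homogeneous coordinates of \<open>A\<^sub>j\<close> and \<open>v\<close> for those of \<open>Q\<close>. By Cramer's rule
  \<open>v = \<alpha>\<^sub>j u\<^bsub>j-1\<^esub> + \<phi>\<^sub>j u\<^sub>j + \<beta>\<^sub>j u\<^bsub>j+1\<^esub>\<close>, where \<open>\<phi>\<^sub>j\<close> is the quotient of determinants in the definition of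
  \<open>L\<^sub>A\<close>; hence \<open>L\<^sub>A v\<close> is the sum of the vectors \<open>\<alpha>\<^sub>j u\<^bsub>j-1\<^esub> + \<beta>\<^sub>j u\<^bsub>j+1\<^esub>\<close>. As \<open>A\<^bsub>j-1\<^esub>A\<^sub>j\<close> and
  \<open>A\<^sub>jA\<^bsub>j+1\<^esub>\<close> are edges, the polygon lies in the cone they span at \<open>A\<^sub>j\<close>, so all coefficients are
  nonnegative. They cannot all vanish, because then \<open>Q\<close> would equal every vertex.
\<close>

lemma hom_coords_nth [simp]:
  "hom_coords p $ 1 = p $ 1" "hom_coords p $ 2 = p $ 2" "hom_coords p $ 3 = 1"
  by (simp_all add: hom_coords_def)

lemma hom_coords_affine:
  "s + t = 1 \<Longrightarrow> hom_coords (s *\<^sub>R p + t *\<^sub>R q) = s *\<^sub>R hom_coords p + t *\<^sub>R hom_coords q"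
  by (simp add: vec_eq_iff forall_3)

lemma affine_point_scaleR_hom_coords: "t \<noteq> 0 \<Longrightarrow> affine_point (t *\<^sub>R hom_coords p) = p"
  by (simp add: affine_point_def vec_eq_iff forall_2)

lemma det3_cramer:
  "det3 a b c *\<^sub>R v = det3 v b c *\<^sub>R a + det3 a v c *\<^sub>R b + det3 a b v *\<^sub>R c"
  by (simp add: vec_eq_iff forall_3 det3_expand algebra_simps)

text \<open>Subtracting the middle column reduces the determinant, up to sign, to the planar
  determinant of \<open>a - b\<close> and \<open>c - b\<close>; if it vanishes, these vectors are
  parallel.\<close>

lemma collinear_if_det3_eq_0:
  assumes "det3 (hom_coords a) (hom_coords b) (hom_coords c) = 0"
  shows "collinear {a, b, c}"
proof -
  define x y where "x = a - b" and "y = c - b"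
  have d: "x $ 1 * y $ 2 = x $ 2 * y $ 1"
    using assms by (simp add: det3_expand x_def y_def algebra_simps)
  have "x = 0 \<or> y = 0 \<or> (\<exists>k. y = k *\<^sub>R x)"
  proof (cases "x $ 1 = 0")
    case True
    show ?thesis
    proof (cases "x $ 2 = 0")
      case True
      with \<open>x $ 1 = 0\<close> show ?thesis by (simp add: vec_eq_iff forall_2)
    next
      case False
      with True d have "y = (y $ 2 / x $ 2) *\<^sub>R x"
        by (simp add: vec_eq_iff forall_2)
      then show ?thesis by blast
    qed
  next
    case False
    with d have "y = (y $ 1 / x $ 1) *\<^sub>R x"
      by (simp add: vec_eq_iff forall_2 field_simps)
    then show ?thesis by blast
  qed
  then have "collinear {0, x, y}"
    by (simp add: collinear_lemma)
  then show ?thesis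
    by (subst collinear_3) (auto simp: x_def y_def)
qed

text \<open>The cone over the copy of \<open>C\<close> at height 1. Admitting \<open>t = 0\<close>
  lets vanishing summands of \<open>L_map\<close> be treated like the others.\<close>

definition hom_cone :: "(real^2) set \<Rightarrow> (real^3) set" where
  "hom_cone C = {t *\<^sub>R hom_coords p | t p. t \<ge> 0 \<and> p \<in> C}"

lemma scaleR_hom_coords_in_hom_cone: "t \<ge> 0 \<Longrightarrow> p \<in> C \<Longrightarrow> t *\<^sub>R hom_coords p \<in> hom_cone C"
  by (auto simp: hom_cone_def)

lemma hom_cone_add:
  assumes "convex C" "x \<in> hom_cone C" "y \<in> hom_cone C"
  shows "x + y \<in> hom_cone C"
proof -
  obtain s p t q where *: "x = s *\<^sub>R hom_coords p" "s \<ge> 0" "p \<in> C"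
      "y = t *\<^sub>R hom_coords q" "t \<ge> 0" "q \<in> C"
    using assms(2,3) by (auto simp: hom_cone_def)
  show ?thesis
  proof (cases "s + t = 0")
    case True
    with * have "x + y = 0 *\<^sub>R hom_coords p" by (simp add: add_nonneg_eq_0_iff)
    with * show ?thesis by (metis order_refl scaleR_hom_coords_in_hom_cone)
  next
    case False
    \<comment> \<open>Heights add, and the new base point is the mean of \<open>p\<close> and
      \<open>q\<close> weighted by the heights.\<close>
    define r where "r = (s / (s + t)) *\<^sub>R p + (t / (s + t)) *\<^sub>R q"
    have sum1: "s / (s + t) + t / (s + t) = 1"
      using False by (simp flip: add_divide_distrib)
    have "r \<in> C"
      unfolding r_def using * sum1 by (intro convexD[OF \<open>convex C\<close>]) auto
    moreover have "x + y = (s + t) *\<^sub>R hom_coords r"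
      unfolding r_def hom_coords_affine[OF sum1] using False * by (simp add: scaleR_right_distrib)
    ultimately show ?thesis
      using * by (simp add: scaleR_hom_coords_in_hom_cone)
  qed
qed

lemma hom_cone_sum:
  assumes "convex C" "C \<noteq> {}" "\<And>j. j \<in> J \<Longrightarrow> f j \<in> hom_cone C"
  shows "sum f J \<in> hom_cone C"
proof -
  have zero: "0 \<in> hom_cone C"
    using assms(2) scaleR_hom_coords_in_hom_cone[of 0] by auto
  show ?thesis
    using assms(3)
    by (induction J rule: infinite_finite_induct) (auto simp: zero hom_cone_add[OF assms(1)])
qed

lemma affine_point_in_if_hom_cone:
  "w \<in> hom_cone C \<Longrightarrow> w $ 3 \<noteq> 0 \<Longrightarrow> affine_point w \<in> C"
  by (auto simp: hom_cone_def affine_point_scaleR_hom_coords)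

text \<open>
  If \<open>\<alpha> < 0\<close>, the segment from \<open>q\<close> to \<open>a\<close> crosses the line \<open>bc\<close> at a point \<open>z\<close> of the face, and the
  face then contains \<open>a\<close>.
\<close>

lemma coeff_nonneg_if_segment_face:
  fixes a b c q :: "'a::euclidean_space"
  assumes "convex P" and face: "closed_segment b c face_of P"
    and "a \<in> P" "q \<in> P" and nc: "\<not> collinear {a, b, c}"
    and q: "q = b + \<alpha> *\<^sub>R (a - b) + \<beta> *\<^sub>R (c - b)"
  shows "\<alpha> \<ge> 0"
proof (rule ccontr)
  assume "\<not> \<alpha> \<ge> 0"
  then have neg: "\<alpha> < 0" by simp
  \<comment> \<open>Chosen so that the coefficient of \<open>a - b\<close> in \<open>z\<close>
    vanishes, which puts \<open>z\<close> on the line through \<open>b\<close> and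
    \<open>c\<close>.\<close>
  define t where "t = - \<alpha> / (1 - \<alpha>)"
  define z where "z = (1 - t) *\<^sub>R q + t *\<^sub>R a"
  have t: "0 < t" "t < 1" and t0: "(1 - t) * \<alpha> + t = 0"
    using neg by (auto simp: t_def field_simps)
  have aff: "affine hull (closed_segment b c) = affine hull {b, c}"
    by (simp add: affine_hull_convex_hull segment_convex_hull)
  have "z = ((1 - t) * \<alpha> + t) *\<^sub>R (a - b) + b + ((1 - t) * \<beta>) *\<^sub>R (c - b)"
    by (simp add: z_def q algebra_simps)
  also have "\<dots> = (1 - (1 - t) * \<beta>) *\<^sub>R b + ((1 - t) * \<beta>) *\<^sub>R c"
    unfolding t0 by (simp add: algebra_simps)
  finally have z_aff: "z \<in> affine hull {b, c}"
    unfolding affine_hull_2 by (metis (mono_tags, lifting) diff_add_cancel mem_Collect_eq)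
  have "z \<in> P"
    unfolding z_def using t assms by (intro convexD) auto
  \<comment> \<open>A face of a convex set is the intersection of the set with the affine hull of
    the face.\<close>
  then have z: "z \<in> closed_segment b c"
    using face_of_imp_eq_affine_Int[OF \<open>convex P\<close> face] z_aff aff by blast
  \<comment> \<open>The face property needs \<open>z\<close> strictly between \<open>q\<close> and
    \<open>a\<close>, hence distinct endpoints; if they coincide, then \<open>z = a\<close> is
    already on the line.\<close>
  have "a \<in> affine hull {b, c}"
  proof (cases "q = a")
    case True
    then have "z = a" by (simp add: z_def algebra_simps)
    with z_aff show ?thesis by simp
  next
    case False
    then have "z \<in> open_segment q a"
      using t by (auto simp: in_segment z_def)
    then have "a \<in> closed_segment b c"
      using face_ofD[OF face] z assms by blast
    then show ?thesis
      by (metis aff hull_inc)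
  qed
  moreover have "b \<noteq> c"
    using nc by auto
  ultimately have "collinear {b, c, a}"
    by (simp add: collinear_3_affine_hull)
  with nc show False
    by (simp add: insert_commute)
qed

text \<open>Third coordinates force the Cramer coefficients to sum to 1, so \<alpha> and \<beta> are
  also the coordinates of \<open>q\<close> along \<open>a - b\<close> and \<open>c - b\<close>. The
  edge \<open>bc\<close> gives the sign of \<alpha>, the edge \<open>ab\<close> that of \<beta>. The
  second equation is kept because it shows \<open>q = b\<close> when both vanish.\<close>

lemma cone_at_vertex:
  assumes "convex P" and "closed_segment a b face_of P" "closed_segment b c face_of P"
    and "q \<in> P" and nc: "\<not> collinear {a, b, c}"
  obtains \<alpha> \<beta> where "\<alpha> \<ge> 0" "\<beta> \<ge> 0"
    "hom_coords q - (det3 (hom_coords a) (hom_coords q) (hom_coords c) /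
        det3 (hom_coords a) (hom_coords b) (hom_coords c)) *\<^sub>R hom_coords b
      = \<alpha> *\<^sub>R hom_coords a + \<beta> *\<^sub>R hom_coords c"
    "q = b + \<alpha> *\<^sub>R (a - b) + \<beta> *\<^sub>R (c - b)"
proof -
  define d where "d = det3 (hom_coords a) (hom_coords b) (hom_coords c)"
  define \<alpha> where "\<alpha> = det3 (hom_coords q) (hom_coords b) (hom_coords c) / d"
  define \<phi> where "\<phi> = det3 (hom_coords a) (hom_coords q) (hom_coords c) / d"
  define \<beta> where "\<beta> = det3 (hom_coords a) (hom_coords b) (hom_coords q) / d"
  have d: "d \<noteq> 0"
    using collinear_if_det3_eq_0 nc by (auto simp: d_def)
  have "hom_coords q = inverse d *\<^sub>R (d *\<^sub>R hom_coords q)"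
    using d by simp
  also have "\<dots> = \<alpha> *\<^sub>R hom_coords a + \<phi> *\<^sub>R hom_coords b + \<beta> *\<^sub>R hom_coords c"
    unfolding d_def by (subst det3_cramer)
      (simp add: \<alpha>_def \<phi>_def \<beta>_def d_def scaleR_right_distrib divide_inverse mult.commute)
  finally have v: "hom_coords q = \<alpha> *\<^sub>R hom_coords a + \<phi> *\<^sub>R hom_coords b + \<beta> *\<^sub>R hom_coords c" .
  then have "\<alpha> + \<phi> + \<beta> = 1"
    by (simp add: vec_eq_iff forall_3)
  then have \<phi>: "\<phi> = 1 - \<alpha> - \<beta>" by simp
  have q: "q = b + \<alpha> *\<^sub>R (a - b) + \<beta> *\<^sub>R (c - b)"
    using v by (simp add: \<phi> vec_eq_iff forall_2 forall_3 algebra_simps)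
  have mem: "a \<in> P" "c \<in> P"
    using assms(2,3) face_of_imp_subset by fastforce+
  have "\<alpha> \<ge> 0"
    using coeff_nonneg_if_segment_face[OF assms(1,3) mem(1) assms(4) nc q] .
  moreover have "\<beta> \<ge> 0"
  proof (rule coeff_nonneg_if_segment_face[OF assms(1) _ mem(2) assms(4)])
    show "closed_segment b a face_of P"
      using assms(2) by (simp add: closed_segment_commute)
    show "\<not> collinear {c, b, a}"
      using nc by (simp add: insert_commute)
    show "q = b + \<beta> *\<^sub>R (c - b) + \<alpha> *\<^sub>R (a - b)"
      using q by simp
  qed
  moreover have "hom_coords q - \<phi> *\<^sub>R hom_coords b = \<alpha> *\<^sub>R hom_coords a + \<beta> *\<^sub>R hom_coords c"
    using v by simp
  ultimately show thesis
    using that q by (simp add: \<phi>_def d_def)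
qed

lemma convex_polygon_cone_at_vertex:
  assumes poly: "convex_polygon A" and "q \<in> convex hull (set A)" and j: "j < length A"
  defines "u \<equiv> \<lambda>i. hom_coords (A ! (i mod length A))"
  shows "\<exists>\<alpha> \<beta>. \<alpha> \<ge> 0 \<and> \<beta> \<ge> 0 \<and>
    hom_coords q - (det3 (u (j + length A - 1)) (hom_coords q) (u (j + 1)) /
        det3 (u (j + length A - 1)) (u j) (u (j + 1))) *\<^sub>R u j
      = \<alpha> *\<^sub>R u (j + length A - 1) + \<beta> *\<^sub>R u (j + 1) \<and>
    (\<alpha> + \<beta> = 0 \<longrightarrow> q = A ! j)"
proof -
  define n where "n = length A"
  define i where "i = (j + n - 1) mod n"
  define k where "k = (j + 1) mod n"
  have n: "n \<ge> 3"
    using poly by (simp add: convex_polygon_def n_def)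
  have i_eq: "i = (if j = 0 then n - 1 else j - 1)"
  proof (cases j)
    case (Suc m)
    then have "i = (m + n) mod n" by (simp add: i_def)
    with Suc j show ?thesis by (simp add: n_def)
  qed (use n in \<open>simp add: i_def\<close>)
  have k_eq: "k = (if j = n - 1 then 0 else j + 1)"
    using j n by (cases "Suc j = n") (auto simp: k_def n_def)
  \<comment> \<open>Three vertices suffice for the two neighbours of \<open>j\<close> to differ.
    \<open>suc\<close> identifies the edge entering \<open>A ! j\<close> as the one that starts at
    index \<open>i\<close>.\<close>
  have lt: "i < n" "k < n" and ne: "i \<noteq> j" "j \<noteq> k" "i \<noteq> k" and suc: "Suc i mod n = j"
    using n j by (auto simp: i_eq k_eq n_def)
  have edges: "closed_segment (A ! m) (A ! (Suc m mod n)) face_of convex hull (set A)"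
    if "m < n" for m
    using poly that by (auto simp: convex_polygon_def n_def edge_of_def)
  have "\<not> collinear {A ! i, A ! j, A ! k}"
    using poly lt ne j by (auto simp: convex_polygon_def n_def)
  then obtain \<alpha> \<beta> where *: "\<alpha> \<ge> 0" "\<beta> \<ge> 0"
    "hom_coords q - (det3 (hom_coords (A ! i)) (hom_coords q) (hom_coords (A ! k)) /
        det3 (hom_coords (A ! i)) (hom_coords (A ! j)) (hom_coords (A ! k))) *\<^sub>R hom_coords (A ! j)
      = \<alpha> *\<^sub>R hom_coords (A ! i) + \<beta> *\<^sub>R hom_coords (A ! k)"
    "q = A ! j + \<alpha> *\<^sub>R (A ! i - A ! j) + \<beta> *\<^sub>R (A ! k - A ! j)"
    using cone_at_vertex[of "convex hull (set A)" "A ! i" "A ! j" "A ! k" q]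
      edges[of i] edges[of j] lt suc j assms(2) by (auto simp: n_def k_def)
  moreover have "q = A ! j" if "\<alpha> + \<beta> = 0"
    using * that by (simp add: add_nonneg_eq_0_iff)
  ultimately show ?thesis
    using j by (intro exI[of _ \<alpha>] exI[of _ \<beta>]) (simp add: u_def i_def k_def n_def)
qed

theorem proposition4p1:
  fixes A :: "(real^2) list" and Q :: "real^2"
  assumes "convex_polygon A"
    and "Q \<in> convex hull (set A)"
  shows "L_map A (hom_coords Q) $ 3 \<noteq> 0 \<and>
         affine_point (L_map A (hom_coords Q)) \<in> convex hull (set A)"
proof -
  define n where "n = length A"
  define u where "u = (\<lambda>i. hom_coords (A ! (i mod n)))"
  define f where "f j = hom_coords Q - (det3 (u (j + n - 1)) (hom_coords Q) (u (j + 1)) /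
        det3 (u (j + n - 1)) (u j) (u (j + 1))) *\<^sub>R u j" for j
  have n: "n \<ge> 3" and dist: "distinct A"
    using assms(1) by (auto simp: convex_polygon_def n_def)
  \<comment> \<open>The \<open>n\<close> copies of the vector are dealt out, one to each
    summand.\<close>
  have L: "L_map A (hom_coords Q) = (\<Sum>j<n. f j)"
    by (simp add: L_map_def Let_def f_def sum_subtractf u_def n_def sum_constant_scaleR del: sum_constant)
  have f: "f j \<in> hom_cone (convex hull (set A)) \<and> f j $ 3 \<ge> 0 \<and> (f j $ 3 = 0 \<longrightarrow> Q = A ! j)"
    if j: "j < n" for j
  proof -
    have "\<exists>\<alpha> \<beta>. \<alpha> \<ge> 0 \<and> \<beta> \<ge> 0 \<and>
        f j = \<alpha> *\<^sub>R u (j + n - 1) + \<beta> *\<^sub>R u (j + 1) \<and> (\<alpha> + \<beta> = 0 \<longrightarrow> Q = A ! j)"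
      using convex_polygon_cone_at_vertex[OF assms j[unfolded n_def]]
      unfolding f_def u_def n_def .
    then obtain \<alpha> \<beta> where *: "\<alpha> \<ge> 0" "\<beta> \<ge> 0"
        "f j = \<alpha> *\<^sub>R u (j + n - 1) + \<beta> *\<^sub>R u (j + 1)" "\<alpha> + \<beta> = 0 \<Longrightarrow> Q = A ! j"
      by blast
    have mem: "A ! (i mod n) \<in> convex hull (set A)" for i
      using n by (intro hull_inc nth_mem) (simp flip: n_def)
    have "f j \<in> hom_cone (convex hull (set A))"
      unfolding *(3) u_def
      by (intro hom_cone_add scaleR_hom_coords_in_hom_cone mem * convex_convex_hull)
    \<comment> \<open>Every \<open>u i\<close> has height 1, so a zero height means that both
      coefficients vanish.\<close>
    moreover have "f j $ 3 = \<alpha> + \<beta>"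
      unfolding *(3) by (simp add: u_def)
    ultimately show ?thesis using * by simp
  qed
  have cone: "L_map A (hom_coords Q) \<in> hom_cone (convex hull (set A))"
    unfolding L using f assms(2) by (intro hom_cone_sum) auto
  have "L_map A (hom_coords Q) $ 3 \<noteq> 0"
  proof
    assume "L_map A (hom_coords Q) $ 3 = 0"
    then have "(\<Sum>j<n. f j $ 3) = 0" by (simp add: L)
    \<comment> \<open>A vanishing sum of nonnegative heights makes each height zero, so
      \<open>Q\<close> would be two distinct vertices at once.\<close>
    then have "\<forall>j<n. f j $ 3 = 0"
      using f by (subst (asm) sum_nonneg_eq_0_iff) auto
    then have "Q = A ! 0" "Q = A ! 1"
      using f n by auto
    then show False
      using dist n nth_eq_iff_index_eq[of A 0 1] by (simp flip: n_def)
  qed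
  with cone show ?thesis
    by (simp add: affine_point_in_if_hom_cone)
qed

end
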